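(* Let $\mathcal H$ be a separable Hilbert space, let $\Phi=(\varphi_n)_n$ and $\Psi=(\psi_n)_n$ be frames for $\mathcal H$ with (lower, upper) frame bounds $A_\Phi,B_\Phi$ and $A_\Psi,B_\Psi$, respectively, and let $m=(m_n)_n$ be a sequence in $\ell^\infty$ such that the frame multiplier $M_{m,\Phi,\Psi}$ is invertible. If $\Phi'=(\varphi'_n)_n$ is a $\mu$-perturbation of $\Phi$, where $$\mu\,\|m\|_\infty<\big(\sqrt{B_\Phi}\,\|M_{m,\Phi,\Psi}^{-1}\|\big)^{-1},$$ then there exists a frame $\Psi'=(\psi'_n)_n$ which is a $\lambda\mu$-perturbation of $\Psi$ for some $\lambda>0$ and $$M_{m,\Phi',\Psi'}=M_{m,\Phi,\Psi}.$$ In particular, the operator properties of $M_{m,\Phi,\Psi}$ are stable under the perturbations of $\Phi$.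
   Context: Sequences are indexed by $n\in\mathbb N$ and $m$ is a sequence of complex scalars. A sequence $\Phi=(\varphi_n)_n$ in $\mathcal H$ is a frame for $\mathcal H$ with lower and upper frame bounds $A_\Phi,B_\Phi$ if $0<A_\Phi\le B_\Phi<\infty$ and $A_\Phi\|f\|^2\le\sum_n|\langle f,\varphi_n\rangle|^2\le B_\Phi\|f\|^2$ for all $f\in\mathcal H$; it is a Bessel sequence if the upper inequality holds. For a Bessel sequence $\Phi$, the analysis operator is $U_\Phi:\mathcal H\to\ell^2$, $U_\Phi f=(\langle f,\varphi_n\rangle)_n$, and the synthesis operator is $T_\Phi:\ell^2\to\mathcal H$, $T_\Phi(c_n)_n=\sum_n c_n\varphi_n$. For $m\in\ell^\infty$, $\mathcal M_m:\ell^2\to\ell^2$ is $\mathcal M_m(c_n)_n=(m_nc_n)_n$, and the multiplier with symbol $m$ is $M_{m,\Phi,\Psi}=T_\Phi\mathcal M_mU_\Psi$, i.e. $M_{m,\Phi,\Psi}f=\sum_{n=1}^\infty m_n\langle f,\psi_n\rangle\varphi_n$; it is called a frame multiplier when $\Phi$ and $\Psi$ are frames. For $\mu>0$, a sequence $\Phi'$ in $\mathcal H$ is a $\mu$-perturbation of $\Phi$ if $\|T_\Phi-T_{\Phi'}\|\le\mu$.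
   Formalization: The smallness condition uses the upper bound B_Ψ of Ψ instead of B_Φ; as printed the claim is false (on the complex numbers: Φ=(1/2,0,...), Ψ=(2,0,...), m=1, μ=1/2, Φ'=0). *)

theory Defs
  imports "HOL-Analysis.Analysis"
begin

section \<open>Complex Hilbert spaces\<close>

text \<open>
  HOL-Analysis only has real inner product spaces. The inner product below is linear in its
  first argument and conjugate linear in the second one.
\<close>

class complex_inner = real_normed_vector +
  fixes scaleC :: "complex \<Rightarrow> 'a \<Rightarrow> 'a"  (infixr "*\<^sub>C" 75)
    and cinner :: "'a \<Rightarrow> 'a \<Rightarrow> complex"
  assumes scaleC_add_right: "a *\<^sub>C (x + y) = a *\<^sub>C x + a *\<^sub>C y"
    and scaleC_add_left: "(a + b) *\<^sub>C x = a *\<^sub>C x + b *\<^sub>C x"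
    and scaleC_scaleC: "a *\<^sub>C (b *\<^sub>C x) = (a * b) *\<^sub>C x"
    and scaleC_of_real: "complex_of_real r *\<^sub>C x = r *\<^sub>R x"
    and cinner_commute: "cinner x y = cnj (cinner y x)"
    and cinner_add_left: "cinner (x + y) z = cinner x z + cinner y z"
    and cinner_scaleC_left: "cinner (a *\<^sub>C x) y = a * cinner x y"
    and cinner_self_nonneg: "0 \<le> Re (cinner x x)"
    and norm_eq_sqrt_cinner: "norm x = sqrt (Re (cinner x x))"

class complex_hilbert_space = complex_inner + complete_space

instantiation complex :: complex_hilbert_space
begin

definition scaleC_complex :: "complex \<Rightarrow> complex \<Rightarrow> complex"
  where "scaleC_complex a x = a * x"

definition cinner_complex :: "complex \<Rightarrow> complex \<Rightarrow> complex"
  where "cinner_complex x y = x * cnj y"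

instance
  by standard
    (auto simp: scaleC_complex_def cinner_complex_def algebra_simps scaleR_conv_of_real cmod_def
      power2_eq_square)

end


section \<open>The sequence space $\ell^2$\<close>

typedef ell2 = "{c :: nat \<Rightarrow> complex. summable (\<lambda>n. (cmod (c n))\<^sup>2)}"
  morphisms ell2_nth Abs_ell2
  by (rule exI[of _ "\<lambda>_. 0"]) simp

lemma summable_ell2: "summable (\<lambda>n. (cmod (ell2_nth c n))\<^sup>2)"
  using ell2_nth[of c] by simp

lemma ell2_nth_Abs: "summable (\<lambda>n. (cmod (c n))\<^sup>2) \<Longrightarrow> ell2_nth (Abs_ell2 c) = c"
  by (simp add: Abs_ell2_inverse)

lemma ell2_eqI: "(\<And>n. ell2_nth c n = ell2_nth d n) \<Longrightarrow> c = d"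
  using ell2_nth_inject by blast

lemma ell2_add_aux:
  fixes c d :: "nat \<Rightarrow> complex"
  assumes c: "summable (\<lambda>n. (cmod (c n))\<^sup>2)" and d: "summable (\<lambda>n. (cmod (d n))\<^sup>2)"
  shows "summable (\<lambda>n. (cmod (c n + d n))\<^sup>2)"
    and "sqrt (\<Sum>n. (cmod (c n + d n))\<^sup>2) \<le> sqrt (\<Sum>n. (cmod (c n))\<^sup>2) + sqrt (\<Sum>n. (cmod (d n))\<^sup>2)"
proof -
  let ?C = "sqrt (\<Sum>n. (cmod (c n))\<^sup>2)" and ?D = "sqrt (\<Sum>n. (cmod (d n))\<^sup>2)"
  have pos: "0 \<le> ?C + ?D"
    by (intro add_nonneg_nonneg real_sqrt_ge_zero suminf_nonneg c d) auto
  have part: "(\<Sum>n<N. (cmod (c n + d n))\<^sup>2) \<le> (?C + ?D)\<^sup>2" for N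
  proof -
    have "L2_set (\<lambda>n. cmod (c n + d n)) {..<N} \<le> L2_set (\<lambda>n. cmod (c n) + cmod (d n)) {..<N}"
      by (intro L2_set_mono norm_triangle_ineq) auto
    also have "\<dots> \<le> L2_set (\<lambda>n. cmod (c n)) {..<N} + L2_set (\<lambda>n. cmod (d n)) {..<N}"
      by (rule L2_set_triangle_ineq)
    also have "\<dots> \<le> ?C + ?D"
      unfolding L2_set_def by (intro add_mono real_sqrt_le_mono sum_le_suminf c d) auto
    finally have "sqrt (\<Sum>n<N. (cmod (c n + d n))\<^sup>2) \<le> ?C + ?D"
      unfolding L2_set_def .
    then show ?thesis
      using sqrt_le_D by blast
  qed
  show s: "summable (\<lambda>n. (cmod (c n + d n))\<^sup>2)"
    by (rule summableI_nonneg_bounded[OF _ part]) auto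
  have "(\<Sum>n. (cmod (c n + d n))\<^sup>2) \<le> (?C + ?D)\<^sup>2"
    by (rule suminf_le_const[OF s part])
  then show "sqrt (\<Sum>n. (cmod (c n + d n))\<^sup>2) \<le> ?C + ?D"
    using pos real_le_lsqrt by blast
qed

lemma summable_scale_ell2:
  "summable (\<lambda>n. (cmod (c n))\<^sup>2) \<Longrightarrow> summable (\<lambda>n. (cmod (a * c n))\<^sup>2)"
  by (simp add: norm_mult power_mult_distrib summable_mult)

lemma summable_ell2_prod:
  fixes c d :: "nat \<Rightarrow> complex"
  assumes c: "summable (\<lambda>n. (cmod (c n))\<^sup>2)" and d: "summable (\<lambda>n. (cmod (d n))\<^sup>2)"
  shows "summable (\<lambda>n. c n * cnj (d n))"
proof (rule summable_comparison_test'[OF summable_add[OF c d]])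
  fix n :: nat
  have "0 \<le> (cmod (c n) - cmod (d n))\<^sup>2" "0 \<le> cmod (c n) * cmod (d n)"
    by simp_all
  then show "norm (c n * cnj (d n)) \<le> (cmod (c n))\<^sup>2 + (cmod (d n))\<^sup>2"
    unfolding power2_diff norm_mult complex_mod_cnj by linarith
qed

instantiation ell2 :: complex_inner
begin

definition "0 = Abs_ell2 (\<lambda>n. 0)"
definition "c + d = Abs_ell2 (\<lambda>n. ell2_nth c n + ell2_nth d n)"
definition "- c = Abs_ell2 (\<lambda>n. - ell2_nth c n)"
definition "c - d = Abs_ell2 (\<lambda>n. ell2_nth c n - ell2_nth d n)"
definition "r *\<^sub>R c = Abs_ell2 (\<lambda>n. complex_of_real r * ell2_nth c n)"
definition "a *\<^sub>C c = Abs_ell2 (\<lambda>n. a * ell2_nth c n)"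
definition "cinner c d = (\<Sum>n. ell2_nth c n * cnj (ell2_nth d n))"
definition "norm c = sqrt (\<Sum>n. (cmod (ell2_nth c n))\<^sup>2)"
definition "sgn c = inverse (norm c) *\<^sub>R (c :: ell2)"
definition "dist c d = norm (c - d :: ell2)"
definition [code del]:
  "(uniformity :: (ell2 \<times> ell2) filter) = (INF e\<in>{0<..}. principal {(x, y). dist x y < e})"
definition [code del]:
  "open (U :: ell2 set) \<longleftrightarrow> (\<forall>x\<in>U. \<forall>\<^sub>F (x', y) in uniformity. x' = x \<longrightarrow> y \<in> U)"

lemma ell2_nth_zero: "ell2_nth 0 n = 0"
  by (simp add: zero_ell2_def ell2_nth_Abs)

lemma ell2_nth_add: "ell2_nth (c + d) n = ell2_nth c n + ell2_nth d n"
  by (simp add: plus_ell2_def ell2_nth_Abs ell2_add_aux summable_ell2)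

lemma ell2_nth_uminus: "ell2_nth (- c) n = - ell2_nth c n"
  by (simp add: uminus_ell2_def ell2_nth_Abs summable_ell2)

lemma ell2_nth_minus: "ell2_nth (c - d) n = ell2_nth c n - ell2_nth d n"
  using ell2_add_aux(1)[OF summable_ell2[of c] summable_ell2[of "- d"]]
  by (simp add: minus_ell2_def ell2_nth_Abs ell2_nth_uminus)

lemma ell2_nth_scaleC: "ell2_nth (a *\<^sub>C c) n = a * ell2_nth c n"
  by (simp add: scaleC_ell2_def ell2_nth_Abs summable_scale_ell2 summable_ell2)

lemma ell2_nth_scaleR: "ell2_nth (r *\<^sub>R c) n = complex_of_real r * ell2_nth c n"
  by (simp add: scaleR_ell2_def ell2_nth_Abs summable_scale_ell2 summable_ell2)

lemmas ell2_nth_simps = ell2_nth_zero ell2_nth_add ell2_nth_uminus ell2_nth_minus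
  ell2_nth_scaleC ell2_nth_scaleR

instance
proof
  fix a b :: complex and r s :: real and c d e :: ell2
  show "c + d + e = c + (d + e)" "c + d = d + c" "0 + c = c" "- c + c = 0" "c - d = c + - d"
    by (auto intro!: ell2_eqI simp: ell2_nth_simps)
  show "r *\<^sub>R (c + d) = r *\<^sub>R c + r *\<^sub>R d" "(r + s) *\<^sub>R c = r *\<^sub>R c + s *\<^sub>R c"
    "r *\<^sub>R s *\<^sub>R c = (r * s) *\<^sub>R c" "1 *\<^sub>R c = c"
    by (auto intro!: ell2_eqI simp: ell2_nth_simps algebra_simps)
  show "a *\<^sub>C (c + d) = a *\<^sub>C c + a *\<^sub>C d" "(a + b) *\<^sub>C c = a *\<^sub>C c + b *\<^sub>C c"
    "a *\<^sub>C b *\<^sub>C c = (a * b) *\<^sub>C c" "complex_of_real r *\<^sub>C c = r *\<^sub>R c"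
    by (auto intro!: ell2_eqI simp: ell2_nth_simps algebra_simps)
  show "sgn c = inverse (norm c) *\<^sub>R c" "dist c d = norm (c - d)"
    by (simp_all only: sgn_ell2_def dist_ell2_def)
  show "(uniformity :: (ell2 \<times> ell2) filter) = (INF e\<in>{0<..}. principal {(x, y). dist x y < e})"
    by (rule uniformity_ell2_def)
  show "open U \<longleftrightarrow> (\<forall>x\<in>U. \<forall>\<^sub>F (x', y) in uniformity. x' = x \<longrightarrow> y \<in> U)" for U :: "ell2 set"
    by (rule open_ell2_def)
  show "norm c = 0 \<longleftrightarrow> c = 0"
    using suminf_eq_zero_iff[OF summable_ell2[of c]]
    by (auto simp: norm_ell2_def ell2_nth_zero intro!: ell2_eqI)
  show "norm (c + d) \<le> norm c + norm d"
    by (simp add: norm_ell2_def ell2_nth_add ell2_add_aux summable_ell2)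
  show "norm (r *\<^sub>R c) = \<bar>r\<bar> * norm c"
    by (simp add: norm_ell2_def ell2_nth_scaleR norm_mult power_mult_distrib suminf_mult
        summable_ell2 real_sqrt_mult)
  have prod: "summable (\<lambda>n. ell2_nth c n * cnj (ell2_nth d n))" for c d
    by (rule summable_ell2_prod) (rule summable_ell2)+
  show "cinner c d = cnj (cinner d c)"
    using bounded_linear.suminf[OF bounded_linear_cnj prod[of d c]]
    by (simp add: cinner_ell2_def mult.commute)
  show "cinner (c + d) e = cinner c e + cinner d e"
    by (simp add: cinner_ell2_def ell2_nth_add ring_distribs suminf_add prod)
  show "cinner (a *\<^sub>C c) d = a * cinner c d"
    by (simp add: cinner_ell2_def ell2_nth_scaleC mult.assoc suminf_mult prod)
  have self: "Re (cinner c c) = (\<Sum>n. (cmod (ell2_nth c n))\<^sup>2)"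
    unfolding cinner_ell2_def bounded_linear.suminf[OF bounded_linear_Re prod]
    by (simp only: cmod_power2) (simp add: power2_eq_square)
  show "0 \<le> Re (cinner c c)"
    unfolding self by (intro suminf_nonneg summable_ell2) auto
  show "norm c = sqrt (Re (cinner c c))"
    unfolding self norm_ell2_def ..
qed

end


section \<open>Frames, Bessel sequences and multipliers\<close>

definition bessel_bound :: "(nat \<Rightarrow> 'a::complex_inner) \<Rightarrow> real \<Rightarrow> bool" where
  "bessel_bound \<Phi> B \<longleftrightarrow> 0 < B \<and>
    (\<forall>f. summable (\<lambda>n. (cmod (cinner f (\<Phi> n)))\<^sup>2) \<and>
         (\<Sum>n. (cmod (cinner f (\<Phi> n)))\<^sup>2) \<le> B * (norm f)\<^sup>2)"

definition bessel :: "(nat \<Rightarrow> 'a::complex_inner) \<Rightarrow> bool" where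
  "bessel \<Phi> \<longleftrightarrow> (\<exists>B. bessel_bound \<Phi> B)"

text \<open>The bounds are any admissible ones, not necessarily the optimal ones.\<close>

definition frame_bounds :: "(nat \<Rightarrow> 'a::complex_inner) \<Rightarrow> real \<Rightarrow> real \<Rightarrow> bool" where
  "frame_bounds \<Phi> A B \<longleftrightarrow> 0 < A \<and> A \<le> B \<and>
    (\<forall>f. summable (\<lambda>n. (cmod (cinner f (\<Phi> n)))\<^sup>2) \<and>
         A * (norm f)\<^sup>2 \<le> (\<Sum>n. (cmod (cinner f (\<Phi> n)))\<^sup>2) \<and>
         (\<Sum>n. (cmod (cinner f (\<Phi> n)))\<^sup>2) \<le> B * (norm f)\<^sup>2)"

definition is_frame :: "(nat \<Rightarrow> 'a::complex_inner) \<Rightarrow> bool" where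
  "is_frame \<Phi> \<longleftrightarrow> (\<exists>A B. frame_bounds \<Phi> A B)"

text \<open>
  The next three operators have their intended meaning for a Bessel sequence \<open>\<Phi>\<close> and a bounded
  sequence \<open>m\<close>; otherwise \<open>Abs_ell2\<close> or the infinite sum may be unspecified.
\<close>

definition analysis_op :: "(nat \<Rightarrow> 'a::complex_inner) \<Rightarrow> 'a \<Rightarrow> ell2" where
  "analysis_op \<Phi> f = Abs_ell2 (\<lambda>n. cinner f (\<Phi> n))"

definition synthesis_op :: "(nat \<Rightarrow> 'a::complex_inner) \<Rightarrow> ell2 \<Rightarrow> 'a" where
  "synthesis_op \<Phi> c = (\<Sum>n. ell2_nth c n *\<^sub>C \<Phi> n)"

definition diag_op :: "(nat \<Rightarrow> complex) \<Rightarrow> ell2 \<Rightarrow> ell2" where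
  "diag_op m c = Abs_ell2 (\<lambda>n. m n * ell2_nth c n)"

definition multiplier ::
    "(nat \<Rightarrow> complex) \<Rightarrow> (nat \<Rightarrow> 'a::complex_inner) \<Rightarrow> (nat \<Rightarrow> 'a) \<Rightarrow> 'a \<Rightarrow> 'a" where
  "multiplier m \<Phi> \<Psi> = synthesis_op \<Phi> \<circ> diag_op m \<circ> analysis_op \<Psi>"

text \<open>
  Since \<open>onorm\<close> is only meaningful for bounded operators, it is required that \<open>\<Phi>'\<close> is a Bessel
  sequence, i.e. that its synthesis operator is defined; this is not a frame condition on \<open>\<Phi>'\<close>.
\<close>

definition perturbation ::
    "real \<Rightarrow> (nat \<Rightarrow> 'a::complex_inner) \<Rightarrow> (nat \<Rightarrow> 'a) \<Rightarrow> bool" where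
  "perturbation \<mu> \<Phi> \<Phi>' \<longleftrightarrow> 0 < \<mu> \<and> bessel \<Phi>' \<and>
    onorm (\<lambda>c. synthesis_op \<Phi> c - synthesis_op \<Phi>' c) \<le> \<mu>"

text \<open>
  The real-linear notion \<open>bounded_linear\<close> suffices: the inverse of a complex-linear bijection is
  complex-linear, and multipliers are complex-linear.
\<close>

definition invertible_op :: "('a::real_normed_vector \<Rightarrow> 'a) \<Rightarrow> bool" where
  "invertible_op M \<longleftrightarrow> bounded_linear M \<and> bij M \<and> bounded_linear (inv M)"

definition sup_norm :: "(nat \<Rightarrow> complex) \<Rightarrow> real" where
  "sup_norm m = (SUP n. cmod (m n))"

text \<open>
  A pitfall for the smallness condition under which a multiplier with frames \<open>\<Phi>\<close>, \<open>\<Psi>\<close> and symbol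
  \<open>m\<close> survives a \<open>\<mu>\<close>-perturbation of \<open>\<Phi>\<close>: perturbing the left sequence changes the multiplier
  by at most \<open>\<mu> * sup_norm m * sqrt B\<close> with \<open>B\<close> an upper bound of the right sequence \<open>\<Psi>\<close>, so \<open>B\<close> is
  the bound which enters. An upper bound of \<open>\<Phi>\<close> (as sometimes printed) would not do: on the
  complex numbers take \<open>\<Phi> = (1/2, 0, 0, ...)\<close>, \<open>\<Psi> = (2, 0, 0, ...)\<close>, \<open>m = (1, 1, ...)\<close> and
  \<open>\<mu> = 1/2\<close>. The multiplier is the identity and \<open>\<mu> < 1 / (1/2)\<close>, but the zero sequence is a
  \<open>\<mu>\<close>-perturbation of \<open>\<Phi>\<close> all of whose multipliers vanish.
\<close>

end

theory Submission
  imports Defs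
begin

text \<open>
  Write \<open>M\<close> for the given multiplier and \<open>M' = M\<^bsub>m,\<Phi>',\<Psi>\<^esub>\<close> for the one in which only the left sequence
  has changed. Factoring \<open>M - M' = (T\<^sub>\<Phi> - T\<^bsub>\<Phi>'\<^esub>) \<M>\<^sub>m U\<^sub>\<Psi>\<close> shows that its norm is at most
  \<open>\<mu> \<parallel>m\<parallel> \<surd>B\<^sub>\<Psi>\<close> (\<open>multiplier_perturbation_le\<close>). Hence \<open>K = M\<^sup>-\<^sup>1 (M - M')\<close> has norm at most
  \<open>q = \<mu> \<parallel>m\<parallel> \<surd>B\<^sub>\<Psi> \<parallel>M\<^sup>-\<^sup>1\<parallel> < 1\<close>, and since \<open>M' = M (1 - K)\<close> the operator
  \<open>G = (1 - K)\<^sup>-\<^sup>1 = M'\<^sup>-\<^sup>1 M\<close> exists (\<open>neumann_inverse\<close>) and satisfies \<open>M' G = M\<close>.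

  It remains to absorb \<open>G\<close> into the right sequence. For \<open>\<psi>'\<^sub>n = G\<^sup>* \<psi>\<^sub>n\<close> one has
  \<open>\<langle>f, \<psi>'\<^sub>n\<rangle> = \<langle>G f, \<psi>\<^sub>n\<rangle>\<close>, that is \<open>U\<^bsub>\<Psi>'\<^esub> = U\<^sub>\<Psi> G\<close>, and therefore
  \<open>M\<^bsub>m,\<Phi>',\<Psi>'\<^esub> = T\<^bsub>\<Phi>'\<^esub> \<M>\<^sub>m U\<^sub>\<Psi> G = M' G = M\<close>. The frame property passes from \<open>\<Psi>\<close> to \<open>\<Psi>'\<close> because \<open>G\<close> is
  bounded above and below, and \<open>\<Psi>'\<close> is close to \<open>\<Psi>\<close> because synthesis is adjoint to analysis:
  \<open>\<parallel>T\<^sub>\<Psi> - T\<^bsub>\<Psi>'\<^esub>\<parallel> = \<parallel>U\<^sub>\<Psi> (1 - G)\<parallel>\<close>, where \<open>1 - G = - K G\<close> has norm at most \<open>q / (1 - q)\<close> and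
  the numerator is proportional to \<open>\<mu>\<close> (\<open>transported_sequence\<close>).

  The vectors \<open>G\<^sup>* \<psi>\<^sub>n\<close> come from the Riesz representation theorem for complex Hilbert spaces
  (\<open>riesz_representation\<close>); this is why complex homogeneity of each operator is carried along
  with its real boundedness.
\<close>

subclass (in complex_hilbert_space) banach ..

section \<open>Complex inner products\<close>

lemma scaleC_minus_right: "a *\<^sub>C (x - y) = a *\<^sub>C x - a *\<^sub>C (y :: 'a::complex_inner)"
  using scaleC_add_right[of a "x - y" y] by simp

lemma scaleC_scaleR: "a *\<^sub>C (r *\<^sub>R x) = r *\<^sub>R (a *\<^sub>C (x :: 'a::complex_inner))"
  by (simp flip: scaleC_of_real add: scaleC_scaleC mult.commute)

lemma cinner_scaleR_left: "cinner (r *\<^sub>R x) y = of_real r * cinner x (y :: 'a::complex_inner)"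
  by (simp flip: scaleC_of_real add: cinner_scaleC_left)

lemma cinner_minus_left: "cinner (x - y) z = cinner x z - cinner y (z :: 'a::complex_inner)"
  using cinner_add_left[of "x - y" y z] by simp

lemma cinner_add_right: "cinner x (y + z) = cinner x y + cinner x (z :: 'a::complex_inner)"
  using cinner_add_left[of y z x] by (metis cinner_commute complex_cnj_add)

lemma cinner_minus_right: "cinner x (y - z) = cinner x y - cinner x (z :: 'a::complex_inner)"
  using cinner_add_right[of x "y - z" z] by simp

lemma cinner_scaleC_right: "cinner x (a *\<^sub>C y) = cnj a * cinner x (y :: 'a::complex_inner)"
  by (metis cinner_scaleC_left cinner_commute complex_cnj_mult)

lemma cinner_scaleR_right: "cinner x (r *\<^sub>R y) = of_real r * cinner x (y :: 'a::complex_inner)"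
  by (simp flip: scaleC_of_real add: cinner_scaleC_right)

lemma cinner_self: "cinner x x = of_real ((norm (x :: 'a::complex_inner))\<^sup>2)"
proof (rule complex_eqI)
  show "Re (cinner x x) = Re (of_real ((norm x)\<^sup>2))"
    by (simp add: norm_eq_sqrt_cinner cinner_self_nonneg)
  have "Im (cinner x x) = - Im (cinner x x)"
    by (subst cinner_commute) simp
  then show "Im (cinner x x) = Im (of_real ((norm x)\<^sup>2))"
    by simp
qed

lemma norm_add_sq:
  "(norm (x + y))\<^sup>2 = (norm x)\<^sup>2 + 2 * Re (cinner y x) + (norm (y :: 'a::complex_inner))\<^sup>2"
proof -
  have "of_real ((norm (x + y))\<^sup>2) = cinner x x + cinner y x + cnj (cinner y x) + cinner y y"
    unfolding cinner_self[symmetric] cinner_add_left cinner_add_right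
    by (simp add: cinner_commute[of x y])
  then have "Re (of_real ((norm (x + y))\<^sup>2))
      = Re (cinner x x + cinner y x + cnj (cinner y x) + cinner y y)"
    by simp
  then show ?thesis
    by (simp add: cinner_self del: of_real_power)
qed

lemma parallelogram:
  "(norm (x + y))\<^sup>2 + (norm (x - y))\<^sup>2 = 2 * (norm x)\<^sup>2 + 2 * (norm (y :: 'a::complex_inner))\<^sup>2"
  using norm_add_sq[of x y] norm_add_sq[of x "- y"] cinner_scaleR_left[of "-1" y x] by simp

lemma norm_scaleC: "norm (a *\<^sub>C x) = cmod a * norm (x :: 'a::complex_inner)"
proof -
  have "complex_of_real ((norm (a *\<^sub>C x))\<^sup>2) = of_real ((cmod a * norm x)\<^sup>2)"
    unfolding cinner_self[symmetric] cinner_scaleC_left cinner_scaleC_right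
    by (simp add: cinner_self power_mult_distrib mult_ac flip: complex_norm_square)
  then have "(norm (a *\<^sub>C x))\<^sup>2 = (cmod a * norm x)\<^sup>2"
    using of_real_eq_iff by blast
  then show ?thesis
    by (simp add: power2_eq_iff_nonneg)
qed

text \<open>
  For \<open>y \<noteq> 0\<close>, expanding \<open>\<parallel>\<parallel>y\<parallel>\<^sup>2 x - \<langle>x, y\<rangle> y\<parallel>\<^sup>2\<close> gives \<open>\<parallel>y\<parallel>\<^sup>2\<close> times the difference of the squared sides, which is
  therefore nonnegative.
\<close>

lemma cauchy_schwarz: "cmod (cinner x y) \<le> norm x * norm (y :: 'a::complex_inner)"
proof (cases "y = 0")
  case True
  then show ?thesis
    using cinner_scaleR_right[of x 0 0] by simp
next
  case False
  define s a where "s = (norm y)\<^sup>2" and "a = cinner x y"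
  have s: "s > 0"
    using False by (simp add: s_def)
  have "complex_of_real ((norm (s *\<^sub>R x - a *\<^sub>C y))\<^sup>2) = of_real (s * (s * (norm x)\<^sup>2 - (cmod a)\<^sup>2))"
    unfolding cinner_self[symmetric] cinner_minus_left cinner_minus_right cinner_scaleC_left
      cinner_scaleC_right cinner_scaleR_left cinner_scaleR_right
    using cinner_commute[of y x]
    by (simp add: cinner_self a_def[symmetric] s_def[symmetric] algebra_simps of_real_mult
        complex_norm_square del: of_real_power)
  then have "(norm (s *\<^sub>R x - a *\<^sub>C y))\<^sup>2 = s * (s * (norm x)\<^sup>2 - (cmod a)\<^sup>2)"
    using of_real_eq_iff by blast
  then have "0 \<le> s * (s * (norm x)\<^sup>2 - (cmod a)\<^sup>2)"
    by (metis zero_le_power2)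
  then have "(cmod a)\<^sup>2 \<le> (norm x * norm y)\<^sup>2"
    using s by (simp add: zero_le_mult_iff s_def power_mult_distrib mult.commute)
  then show ?thesis
    unfolding a_def by (rule power2_le_imp_le) simp
qed

lemma bounded_linear_cinner_left: "bounded_linear (\<lambda>x. cinner x (y :: 'a::complex_inner))"
  by (rule bounded_linear_intro[where K = "norm y"])
    (auto simp: cinner_add_left cinner_scaleR_left cauchy_schwarz scaleR_conv_of_real)

lemma bounded_linear_cinner_right: "bounded_linear (\<lambda>y. cinner (x :: 'a::complex_inner) y)"
  by (rule bounded_linear_intro[where K = "norm x"])
    (auto simp: cinner_add_right cinner_scaleR_right cauchy_schwarz scaleR_conv_of_real
      mult.commute[of _ "norm x"])

lemma bounded_linear_scaleC: "bounded_linear (\<lambda>x :: 'a::complex_inner. a *\<^sub>C x)"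
  by (rule bounded_linear_intro[where K = "cmod a"])
    (auto simp: scaleC_add_right scaleC_scaleR norm_scaleC mult.commute)

text \<open>
  The representing vector is the minimiser of \<open>J x = \<parallel>x\<parallel>\<^sup>2 - 2 Re (F x)\<close>. If \<open>F = \<langle>_, z\<rangle>\<close>, then
  \<open>J x = \<parallel>x - z\<parallel>\<^sup>2 - \<parallel>z\<parallel>\<^sup>2\<close>, so there is no other candidate. By the parallelogram law minimising
  sequences are Cauchy, so completeness yields a minimiser \<open>z\<close>, and stationarity of \<open>J\<close> at \<open>z\<close>
  along every real line says \<open>Re \<langle>y, z\<rangle> = Re (F y)\<close>. The imaginary parts follow by replacing \<open>y\<close>
  with \<open>\<i> y\<close>.
\<close>

lemma riesz_representation:
  fixes F :: "'a::complex_hilbert_space \<Rightarrow> complex"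
  assumes F: "bounded_linear F" and FC: "\<And>a x. F (a *\<^sub>C x) = a * F x"
  shows "\<exists>z. \<forall>x. F x = cinner x z"
proof -
  interpret F: bounded_linear F by fact
  define J where "J x = (norm x)\<^sup>2 - 2 * Re (F x)" for x
  obtain K where K: "\<And>x. norm (F x) \<le> norm x * K"
    using F.bounded by blast
  have below: "- K\<^sup>2 \<le> J x" for x
  proof -
    have "Re (F x) \<le> norm x * K"
      using K[of x] complex_Re_le_cmod[of "F x"] by linarith
    moreover have "0 \<le> (norm x - K)\<^sup>2"
      by simp
    ultimately show ?thesis
      unfolding J_def power2_diff by linarith
  qed
  define d where "d = Inf (range J)"
  have d_le: "d \<le> J x" for x
    unfolding d_def by (rule cInf_lower) (auto intro!: bdd_belowI2 below)
  have "\<exists>x. J x < d + inverse (real (Suc n))" for n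
  proof -
    have "Inf (range J) < d + inverse (real (Suc n))"
      by (simp add: d_def)
    then show ?thesis
      using cInf_lessD by blast
  qed
  then obtain x where x: "\<And>n. J (x n) < d + inverse (real (Suc n))"
    by metis
  have dist_le: "(norm (y - z))\<^sup>2 \<le> 2 * (J y - d) + 2 * (J z - d)" for y z
  proof -
    have "J ((1/2) *\<^sub>R (y + z)) = (norm (y + z))\<^sup>2 / 4 - Re (F y) - Re (F z)"
      unfolding J_def F.scaleR F.add by (simp add: power_divide add_divide_distrib)
    then show ?thesis
      using parallelogram[of y z] d_le[of "(1/2) *\<^sub>R (y + z)"] by (simp add: J_def)
  qed
  have "Cauchy x"
  proof (rule metric_CauchyI)
    fix e :: real
    assume e: "e > 0"
    obtain N where N: "inverse (real (Suc N)) < e\<^sup>2 / 4"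
      using reals_Archimedean[of "e\<^sup>2 / 4"] e by auto
    have small: "J (x n) - d < e\<^sup>2 / 4" if "n \<ge> N" for n
    proof -
      have "inverse (real (Suc n)) \<le> inverse (real (Suc N))"
        using that by (simp add: field_simps)
      then show ?thesis
        using x[of n] N by linarith
    qed
    have "dist (x i) (x j) < e" if "i \<ge> N" "j \<ge> N" for i j
    proof -
      have "2 * (J (x i) - d) + 2 * (J (x j) - d) < e\<^sup>2"
        using small[OF that(1)] small[OF that(2)] by (simp add: field_simps)
      with dist_le have "(norm (x i - x j))\<^sup>2 < e\<^sup>2"
        by (rule le_less_trans)
      then show ?thesis
        using e by (simp add: dist_norm power_less_imp_less_base)
    qed
    then show "\<exists>M. \<forall>i\<ge>M. \<forall>j\<ge>M. dist (x i) (x j) < e"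
      by blast
  qed
  then obtain z where z: "x \<longlonglongrightarrow> z"
    using Cauchy_convergent convergent_def by blast
  have "J z \<le> d"
  proof (rule LIMSEQ_le)
    show "(\<lambda>n. J (x n)) \<longlonglongrightarrow> J z"
      unfolding J_def by (intro tendsto_intros F.tendsto z)
    show "(\<lambda>n. d + inverse (real (Suc n))) \<longlonglongrightarrow> d"
      using LIMSEQ_inverse_real_of_nat_add .
    show "\<exists>N. \<forall>n\<ge>N. J (x n) \<le> d + inverse (real (Suc n))"
      using x less_imp_le by blast
  qed
  then have min: "J z \<le> J y" for y
    using d_le order_trans by blast
  have re: "Re (cinner y z) = Re (F y)" for y
  proof (rule ccontr)
    define b where "b = Re (cinner y z) - Re (F y)"
    assume "Re (cinner y z) \<noteq> Re (F y)"
    then have b: "b \<noteq> 0"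
      by (simp add: b_def)
    \<comment> \<open>Along the line \<open>z + t y\<close> the functional \<open>J\<close> is the parabola \<open>J z + 2 t b + t\<^sup>2 \<parallel>y\<parallel>\<^sup>2\<close>. This \<open>t\<close> is
      its minimiser with \<open>\<parallel>y\<parallel>\<^sup>2\<close> replaced by \<open>\<parallel>y\<parallel>\<^sup>2 + 1\<close>, which avoids the case \<open>y = 0\<close>.\<close>
    define t where "t = - b / ((norm y)\<^sup>2 + 1)"
    have "J (z + t *\<^sub>R y) = J z + 2 * t * b + t\<^sup>2 * (norm y)\<^sup>2"
      unfolding J_def norm_add_sq F.add F.scaleR cinner_scaleR_left
      by (simp add: b_def power_mult_distrib algebra_simps)
    then have "0 \<le> 2 * t * b + t\<^sup>2 * (norm y)\<^sup>2"
      using min[of "z + t *\<^sub>R y"] by linarith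
    moreover have "t * ((norm y)\<^sup>2 + 1) = - b"
      unfolding t_def using zero_le_power2[of "norm y"] by (simp add: add_nonneg_eq_0_iff)
    then have "t\<^sup>2 * (norm y)\<^sup>2 = - (t * b) - t\<^sup>2"
      by (simp add: algebra_simps power2_eq_square)
        (metis add.commute distrib_left mult.commute mult_minus_left add_diff_cancel)
    moreover have "t * b \<le> 0"
      unfolding t_def by simp
    moreover have "t\<^sup>2 > 0"
      using b zero_le_power2[of "norm y"] by (simp add: t_def add_nonneg_eq_0_iff)
    ultimately show False
      by linarith
  qed
  have "F y = cinner y z" for y
  proof (rule complex_eqI)
    show "Re (F y) = Re (cinner y z)"
      using re by simp
    show "Im (F y) = Im (cinner y z)"
      using re[of "\<i> *\<^sub>C y"] by (simp add: FC cinner_scaleC_left)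
  qed
  then show ?thesis
    by blast
qed

section \<open>Analysis and synthesis operators\<close>

lemma frame_bounds_imp_bessel_bound: "frame_bounds \<Phi> A B \<Longrightarrow> bessel_bound \<Phi> B"
  by (auto simp: frame_bounds_def bessel_bound_def)

lemma ell2_nth_analysis:
  assumes "bessel_bound \<Phi> B"
  shows "ell2_nth (analysis_op \<Phi> f) n = cinner f (\<Phi> n)"
  using assms by (simp add: analysis_op_def ell2_nth_Abs bessel_bound_def)

lemma norm_analysis_le:
  assumes "bessel_bound \<Phi> B"
  shows "norm (analysis_op \<Phi> f) \<le> sqrt B * norm f"
proof -
  have "sqrt (\<Sum>n. (cmod (cinner f (\<Phi> n)))\<^sup>2) \<le> sqrt (B * (norm f)\<^sup>2)"
    using assms by (intro real_sqrt_le_mono) (simp add: bessel_bound_def)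
  then show ?thesis
    by (simp add: norm_ell2_def ell2_nth_analysis[OF assms] real_sqrt_mult)
qed

lemma bounded_linear_analysis:
  assumes "bessel_bound \<Phi> B"
  shows "bounded_linear (analysis_op \<Phi>)"
proof (rule bounded_linear_intro[where K = "sqrt B"])
  show "norm (analysis_op \<Phi> f) \<le> norm f * sqrt B" for f
    using norm_analysis_le[OF assms] by (simp add: mult.commute)
qed (auto intro!: ell2_eqI
    simp: ell2_nth_simps ell2_nth_analysis[OF assms] cinner_add_left cinner_scaleR_left)

lemma analysis_scaleC:
  "bessel_bound \<Phi> B \<Longrightarrow> analysis_op \<Phi> (a *\<^sub>C f) = a *\<^sub>C analysis_op \<Phi> f"
  by (rule ell2_eqI) (simp add: ell2_nth_simps ell2_nth_analysis cinner_scaleC_left)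

text \<open>
  A finite piece \<open>w = \<Sum>n\<in>I. c\<^sub>n \<phi>\<^sub>n\<close> of the series is estimated by pairing it with itself:
  \<open>\<parallel>w\<parallel>\<^sup>2\<close> is the finite sum of \<open>cnj (c\<^sub>n) \<langle>w, \<phi>\<^sub>n\<rangle>\<close>, to which the Cauchy-Schwarz inequality and the
  Bessel inequality for \<open>w\<close> apply. This gives \<open>\<parallel>w\<parallel>\<^sup>2 \<le> B (\<Sum>n\<in>I. \<bar>c\<^sub>n\<bar>\<^sup>2)\<close>, so the series inherits the
  Cauchy property of \<open>\<Sum>n. \<bar>c\<^sub>n\<bar>\<^sup>2\<close>.
\<close>

lemma summable_synthesis:
  fixes \<Phi> :: "nat \<Rightarrow> 'a::complex_hilbert_space"
  assumes "bessel_bound \<Phi> B"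
  shows "summable (\<lambda>n. ell2_nth c n *\<^sub>C \<Phi> n)"
proof -
  have B: "B > 0" and sum: "\<And>f. summable (\<lambda>n. (cmod (cinner f (\<Phi> n)))\<^sup>2)"
    and le: "\<And>f. (\<Sum>n. (cmod (cinner f (\<Phi> n)))\<^sup>2) \<le> B * (norm f)\<^sup>2"
    using assms by (auto simp: bessel_bound_def)
  have finite_sum: "(norm (\<Sum>n\<in>I. ell2_nth c n *\<^sub>C \<Phi> n))\<^sup>2 \<le> B * (\<Sum>n\<in>I. (cmod (ell2_nth c n))\<^sup>2)"
    if I: "finite I" for I
  proof -
    define w where "w = (\<Sum>n\<in>I. ell2_nth c n *\<^sub>C \<Phi> n)"
    let ?C = "L2_set (\<lambda>n. cmod (ell2_nth c n)) I"
    have "(norm w)\<^sup>2 = cmod (cinner w w)"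
      by (simp add: cinner_self norm_power)
    also have "cinner w w = (\<Sum>n\<in>I. cnj (ell2_nth c n) * cinner w (\<Phi> n))"
      by (subst (2) w_def)
        (simp add: linear_sum[OF bounded_linear.linear[OF bounded_linear_cinner_right]]
          cinner_scaleC_right)
    also have "cmod \<dots> \<le> (\<Sum>n\<in>I. cmod (ell2_nth c n) * cmod (cinner w (\<Phi> n)))"
      by (rule order_trans[OF norm_sum]) (simp add: norm_mult)
    also have "\<dots> \<le> ?C * L2_set (\<lambda>n. cmod (cinner w (\<Phi> n))) I"
      using L2_set_mult_ineq[of "\<lambda>n. cmod (ell2_nth c n)" "\<lambda>n. cmod (cinner w (\<Phi> n))" I] by simp
    also have "\<dots> \<le> ?C * sqrt (B * (norm w)\<^sup>2)"
      unfolding L2_set_def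
      by (intro mult_left_mono real_sqrt_le_mono order_trans[OF sum_le_suminf le] sum I)
        (auto intro: sum_nonneg)
    finally have "norm w * norm w \<le> (?C * sqrt B) * norm w"
      by (simp add: real_sqrt_mult power2_eq_square mult_ac)
    then have "norm w \<le> ?C * sqrt B"
      using mult_right_le_imp_le[of "norm w" "norm w" "?C * sqrt B"] B
      by (cases "w = 0") (auto intro: mult_nonneg_nonneg)
    then have "(norm w)\<^sup>2 \<le> (?C * sqrt B)\<^sup>2"
      by (intro power_mono) auto
    then show ?thesis
      using B by (simp add: w_def L2_set_def power_mult_distrib sum_nonneg mult.commute)
  qed
  show ?thesis
    unfolding summable_Cauchy
  proof (intro allI impI)
    fix e :: real
    assume e: "e > 0"
    then obtain N where N: "\<And>i j. i \<ge> N \<Longrightarrow> norm (\<Sum>n\<in>{i..<j}. (cmod (ell2_nth c n))\<^sup>2) < e\<^sup>2 / B"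
      using summable_ell2[of c] B unfolding summable_Cauchy
      by (meson divide_pos_pos zero_less_power)
    have "norm (\<Sum>n\<in>{i..<j}. ell2_nth c n *\<^sub>C \<Phi> n) < e" if "i \<ge> N" for i j
    proof -
      have "(norm (\<Sum>n\<in>{i..<j}. ell2_nth c n *\<^sub>C \<Phi> n))\<^sup>2 < e\<^sup>2"
        using finite_sum[of "{i..<j}"] N[OF that, of j] B
        by (simp add: sum_nonneg field_simps)
      then show ?thesis
        using e by (simp add: power_less_imp_less_base)
    qed
    then show "\<exists>N. \<forall>m\<ge>N. \<forall>n. norm (\<Sum>n\<in>{m..<n}. ell2_nth c n *\<^sub>C \<Phi> n) < e"
      by blast
  qed
qed

lemma cinner_synthesis:
  fixes \<Phi> :: "nat \<Rightarrow> 'a::complex_hilbert_space"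
  assumes "bessel_bound \<Phi> B"
  shows "cinner f (synthesis_op \<Phi> c) = cinner (analysis_op \<Phi> f) c"
  unfolding synthesis_op_def cinner_ell2_def ell2_nth_analysis[OF assms]
  by (subst bounded_linear.suminf[OF bounded_linear_cinner_right summable_synthesis[OF assms]])
    (simp add: cinner_scaleC_right mult.commute)

text \<open>
  The bound is the one for analysis, transferred by adjointness: for \<open>w = T\<^sub>\<Phi> c\<close>,
  \<open>\<parallel>w\<parallel>\<^sup>2 = \<langle>U\<^sub>\<Phi> w, c\<rangle> \<le> \<surd>B \<parallel>w\<parallel> \<parallel>c\<parallel>\<close>.
\<close>

lemma bounded_linear_synthesis:
  fixes \<Phi> :: "nat \<Rightarrow> 'a::complex_hilbert_space"
  assumes "bessel_bound \<Phi> B"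
  shows "bounded_linear (synthesis_op \<Phi>)"
proof (rule bounded_linear_intro[where K = "sqrt B"])
  have B: "B > 0"
    using assms by (simp add: bessel_bound_def)
  note s = summable_synthesis[OF assms]
  show "synthesis_op \<Phi> (c + d) = synthesis_op \<Phi> c + synthesis_op \<Phi> d" for c d
    by (simp add: synthesis_op_def ell2_nth_simps scaleC_add_left suminf_add s)
  show "synthesis_op \<Phi> (r *\<^sub>R c) = r *\<^sub>R synthesis_op \<Phi> c" for r c
    by (simp add: synthesis_op_def ell2_nth_simps suminf_scaleR_right s
        flip: scaleC_scaleC scaleC_of_real)
      (simp add: scaleC_of_real suminf_scaleR_right s)
  fix c
  let ?w = "synthesis_op \<Phi> c"
  have "norm ?w * norm ?w = cmod (cinner ?w ?w)"
    by (simp add: cinner_self power2_eq_square norm_mult)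
  also have "\<dots> \<le> norm (analysis_op \<Phi> ?w) * norm c"
    unfolding cinner_synthesis[OF assms] by (rule cauchy_schwarz)
  also have "\<dots> \<le> (norm c * sqrt B) * norm ?w"
    using mult_right_mono[OF norm_analysis_le[OF assms, of ?w], of "norm c"] by (simp add: mult_ac)
  finally show "norm ?w \<le> norm c * sqrt B"
    using mult_right_le_imp_le[of "norm ?w" "norm ?w" "norm c * sqrt B"] B
    by (cases "?w = 0") auto
qed

lemma synthesis_scaleC:
  fixes \<Phi> :: "nat \<Rightarrow> 'a::complex_hilbert_space"
  assumes "bessel_bound \<Phi> B"
  shows "synthesis_op \<Phi> (a *\<^sub>C c) = a *\<^sub>C synthesis_op \<Phi> c"
  unfolding synthesis_op_def
  by (subst bounded_linear.suminf[OF bounded_linear_scaleC summable_synthesis[OF assms]])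
    (simp add: ell2_nth_simps scaleC_scaleC)

section \<open>Multipliers\<close>

lemma cmod_le_sup_norm: "bounded (range m) \<Longrightarrow> cmod (m n) \<le> sup_norm m"
  unfolding sup_norm_def by (intro cSUP_upper) (auto simp: bounded_iff intro: bdd_aboveI)

lemma sup_norm_nonneg: "bounded (range m) \<Longrightarrow> 0 \<le> sup_norm m"
  using cmod_le_sup_norm[of m 0] norm_ge_zero order_trans by blast

lemma diag_op_bounds:
  assumes m: "bounded (range m)"
  shows ell2_nth_diag: "ell2_nth (diag_op m c) n = m n * ell2_nth c n"
    and norm_diag_le: "norm (diag_op m c) \<le> sup_norm m * norm c"
proof -
  have le: "(cmod (m n * ell2_nth c n))\<^sup>2 \<le> (sup_norm m)\<^sup>2 * (cmod (ell2_nth c n))\<^sup>2" for n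
    unfolding norm_mult power_mult_distrib
    by (intro mult_right_mono power_mono cmod_le_sup_norm m) auto
  have s: "summable (\<lambda>n. (sup_norm m)\<^sup>2 * (cmod (ell2_nth c n))\<^sup>2)"
    by (intro summable_mult summable_ell2)
  have s': "summable (\<lambda>n. (cmod (m n * ell2_nth c n))\<^sup>2)"
    by (rule summable_comparison_test'[OF s]) (use le in auto)
  show nth: "ell2_nth (diag_op m c) n = m n * ell2_nth c n" for n
    by (simp add: diag_op_def ell2_nth_Abs s')
  have "sqrt (\<Sum>n. (cmod (m n * ell2_nth c n))\<^sup>2) \<le> sqrt ((sup_norm m)\<^sup>2 * (\<Sum>n. (cmod (ell2_nth c n))\<^sup>2))"
    using suminf_le[OF le s' s] by (simp add: suminf_mult summable_ell2)
  then show "norm (diag_op m c) \<le> sup_norm m * norm c"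
    by (simp add: norm_ell2_def nth real_sqrt_mult sup_norm_nonneg[OF m])
qed

lemma bounded_linear_diag:
  assumes m: "bounded (range m)"
  shows "bounded_linear (diag_op m)"
proof (rule bounded_linear_intro[where K = "sup_norm m"])
  show "norm (diag_op m c) \<le> norm c * sup_norm m" for c
    using norm_diag_le[OF m] by (simp add: mult.commute)
qed (auto intro!: ell2_eqI simp: ell2_nth_simps ell2_nth_diag[OF m] algebra_simps)

lemma diag_scaleC: "bounded (range m) \<Longrightarrow> diag_op m (a *\<^sub>C c) = a *\<^sub>C diag_op m c"
  by (rule ell2_eqI) (simp add: ell2_nth_simps ell2_nth_diag)

lemma bounded_linear_multiplier:
  fixes \<Phi> \<Psi> :: "nat \<Rightarrow> 'a::complex_hilbert_space"
  assumes "bessel_bound \<Phi> B" "bessel_bound \<Psi> B'" "bounded (range m)"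
  shows "bounded_linear (multiplier m \<Phi> \<Psi>)"
  unfolding multiplier_def comp_def
  using assms
  by (intro bounded_linear_compose[OF bounded_linear_synthesis]
      bounded_linear_compose[OF bounded_linear_diag] bounded_linear_analysis)

lemma multiplier_scaleC:
  fixes \<Phi> \<Psi> :: "nat \<Rightarrow> 'a::complex_hilbert_space"
  assumes "bessel_bound \<Phi> B" "bessel_bound \<Psi> B'" "bounded (range m)"
  shows "multiplier m \<Phi> \<Psi> (a *\<^sub>C f) = a *\<^sub>C multiplier m \<Phi> \<Psi> f"
  using assms by (simp add: multiplier_def analysis_scaleC diag_scaleC synthesis_scaleC)

text \<open>
  Both multipliers apply their synthesis operator to the same vector \<open>\<M>\<^sub>m U\<^sub>\<Psi> f\<close>, whose norm is
  controlled by the upper bound of the right sequence.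
\<close>

lemma multiplier_perturbation_le:
  fixes \<Phi> \<Psi> \<Phi>' :: "nat \<Rightarrow> 'a::complex_hilbert_space"
  assumes \<Phi>: "bessel_bound \<Phi> C" and \<Psi>: "bessel_bound \<Psi> B" and m: "bounded (range m)"
    and pert: "perturbation \<mu> \<Phi> \<Phi>'"
  shows "norm (multiplier m \<Phi> \<Psi> f - multiplier m \<Phi>' \<Psi> f) \<le> \<mu> * (sup_norm m * (sqrt B * norm f))"
proof -
  obtain C' where \<Phi>': "bessel_bound \<Phi>' C'"
    using pert by (auto simp: perturbation_def bessel_def)
  define c where "c = diag_op m (analysis_op \<Psi> f)"
  have "bounded_linear (\<lambda>c. synthesis_op \<Phi> c - synthesis_op \<Phi>' c)"
    by (intro bounded_linear_sub bounded_linear_synthesis[OF \<Phi>] bounded_linear_synthesis[OF \<Phi>'])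
  from onorm[OF this, of c]
  have "norm (multiplier m \<Phi> \<Psi> f - multiplier m \<Phi>' \<Psi> f)
      \<le> onorm (\<lambda>c. synthesis_op \<Phi> c - synthesis_op \<Phi>' c) * norm c"
    by (simp add: multiplier_def c_def)
  also have "\<dots> \<le> \<mu> * norm c"
    using pert by (intro mult_right_mono) (auto simp: perturbation_def)
  also have "norm c \<le> sup_norm m * (sqrt B * norm f)"
    unfolding c_def
    by (intro order_trans[OF norm_diag_le[OF m]] mult_left_mono norm_analysis_le[OF \<Psi>]
        sup_norm_nonneg m)
  finally show ?thesis
    using pert by (simp add: perturbation_def mult_left_mono)
qed

section \<open>Perturbing the identity and the right sequence\<close>

text \<open>
  Solving \<open>x - K x = y\<close> means finding a fixed point of \<open>x \<mapsto> y + K x\<close>, which is a contraction. The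
  estimate \<open>(1 - q) \<parallel>x\<parallel> \<le> \<parallel>x - K x\<parallel>\<close> makes the solution unique, and uniqueness makes the
  solution operator \<open>G\<close> linear over the complex numbers; the same estimate bounds it.
\<close>

lemma neumann_inverse:
  fixes K :: "'a::complex_hilbert_space \<Rightarrow> 'a"
  assumes K: "bounded_linear K" and KC: "\<And>a x. K (a *\<^sub>C x) = a *\<^sub>C K x"
    and q: "q < 1" and Kq: "\<And>x. norm (K x) \<le> q * norm x"
  shows "\<exists>G. bounded_linear G \<and> (\<forall>a x. G (a *\<^sub>C x) = a *\<^sub>C G x) \<and> (\<forall>x. G x - K (G x) = x) \<and>
    (\<forall>x. norm (G x) \<le> norm x / (1 - q))"
proof -
  interpret K: bounded_linear K by fact
  have "\<exists>x. x - K x = y" for y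
  proof -
    have "\<exists>!x. x \<in> UNIV \<and> y + K x = x"
    \<comment> \<open>On the zero space \<open>q\<close> may be negative, hence the contraction constant \<open>max 0 q\<close>.\<close>
    proof (rule Banach_fix[where c = "max 0 q"])
      show "complete (UNIV :: 'a set)"
        by (simp add: complete_UNIV)
      show "max 0 q < 1"
        using q by simp
      show "dist (y + K u) (y + K v) \<le> max 0 q * dist u v" for u v
      proof -
        have "dist (y + K u) (y + K v) \<le> q * dist u v"
          using Kq[of "u - v"] by (simp add: dist_norm K.diff)
        also have "\<dots> \<le> max 0 q * dist u v"
          by (intro mult_right_mono) auto
        finally show ?thesis .
      qed
    qed auto
    then show ?thesis
      by (metis add_diff_cancel_right')
  qed
  then obtain G where G: "\<And>y. G y - K (G y) = y"
    by metis
  have bound: "norm u \<le> norm (u - K u) / (1 - q)" for u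
    using norm_triangle_ineq2[of u "K u"] Kq[of u] q by (simp add: field_simps)
  have uniq: "G y = u" if "u - K u = y" for y u
  proof -
    have "(G y - u) - K (G y - u) = (G y - K (G y)) - (u - K u)"
      by (simp add: K.diff)
    then have "norm (G y - u) \<le> 0"
      using bound[of "G y - u"] by (simp add: G that)
    then show ?thesis
      by simp
  qed
  have le: "norm (G y) \<le> norm y / (1 - q)" for y
    using bound[of "G y"] by (simp add: G)
  have "bounded_linear G"
  proof (rule bounded_linear_intro[where K = "1 / (1 - q)"])
    fix x y :: 'a and r :: real
    have "(G x + G y) - K (G x + G y) = (G x - K (G x)) + (G y - K (G y))"
      by (simp add: K.add)
    then show "G (x + y) = G x + G y"
      by (intro uniq) (simp add: G)
    have "r *\<^sub>R G x - K (r *\<^sub>R G x) = r *\<^sub>R (G x - K (G x))"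
      by (simp add: K.scaleR scaleR_diff_right)
    then show "G (r *\<^sub>R x) = r *\<^sub>R G x"
      by (intro uniq) (simp add: G)
    show "norm (G x) \<le> norm x * (1 / (1 - q))"
      using le[of x] by simp
  qed
  moreover have "G (a *\<^sub>C x) = a *\<^sub>C G x" for a x
    by (rule uniq) (simp add: KC G flip: scaleC_minus_right)
  ultimately show ?thesis
    using G le by blast
qed

text \<open>
  The sequence is \<open>\<psi>'\<^sub>n = G\<^sup>* \<psi>\<^sub>n\<close>. Its analysis operator is \<open>U\<^sub>\<Psi> G\<close>, so it is a frame with bounds
  \<open>A a\<^sup>2\<close> and \<open>B b\<^sup>2\<close>. For \<open>w = (T\<^sub>\<Psi> - T\<^bsub>\<Psi>'\<^esub>) c\<close>, adjointness gives \<open>\<parallel>w\<parallel>\<^sup>2 = \<langle>U\<^sub>\<Psi> (w - G w), c\<rangle>\<close>, which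
  transfers the distance of \<open>G\<close> from the identity to the synthesis operators.
\<close>

lemma transported_sequence:
  fixes \<Psi> :: "nat \<Rightarrow> 'a::complex_hilbert_space"
  assumes \<Psi>: "frame_bounds \<Psi> A B"
    and G: "bounded_linear G" and GC: "\<And>a x. G (a *\<^sub>C x) = a *\<^sub>C G x"
    and low: "0 < a" "\<And>x. a * norm x \<le> norm (G x)"
    and up: "\<And>x. norm (G x) \<le> b * norm x" "a \<le> b"
    and near: "0 \<le> e" "\<And>x. norm (x - G x) \<le> e * norm x"
  shows "\<exists>\<Psi>'. is_frame \<Psi>' \<and> analysis_op \<Psi>' = analysis_op \<Psi> \<circ> G \<and>
    onorm (\<lambda>c. synthesis_op \<Psi> c - synthesis_op \<Psi>' c) \<le> sqrt B * e"
proof -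
  have A: "0 < A" "A \<le> B" and sum: "\<And>f. summable (\<lambda>n. (cmod (cinner f (\<Psi> n)))\<^sup>2)"
    and lo: "\<And>f. A * (norm f)\<^sup>2 \<le> (\<Sum>n. (cmod (cinner f (\<Psi> n)))\<^sup>2)"
    and hi: "\<And>f. (\<Sum>n. (cmod (cinner f (\<Psi> n)))\<^sup>2) \<le> B * (norm f)\<^sup>2"
    using \<Psi> by (auto simp: frame_bounds_def)
  have bB: "bessel_bound \<Psi> B"
    using \<Psi> by (rule frame_bounds_imp_bessel_bound)
  have "\<exists>z. \<forall>x. cinner (G x) (\<Psi> n) = cinner x z" for n
    by (rule riesz_representation)
      (auto intro: bounded_linear_compose[OF bounded_linear_cinner_left G]
        simp: GC cinner_scaleC_left)
  then obtain \<Psi>' where \<Psi>': "\<And>n x. cinner x (\<Psi>' n) = cinner (G x) (\<Psi> n)"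
    by metis
  have fr: "frame_bounds \<Psi>' (A * a\<^sup>2) (B * b\<^sup>2)"
    unfolding frame_bounds_def \<Psi>'
  proof (intro conjI allI sum)
    show "0 < A * a\<^sup>2"
      using A low by simp
    show "A * a\<^sup>2 \<le> B * b\<^sup>2"
      using A low up by (intro mult_mono power_mono) auto
    fix f
    have "(a * norm f)\<^sup>2 \<le> (norm (G f))\<^sup>2"
      using low by (intro power_mono) auto
    then have "A * (a * norm f)\<^sup>2 \<le> A * (norm (G f))\<^sup>2"
      using A by (intro mult_left_mono) auto
    then show "A * a\<^sup>2 * (norm f)\<^sup>2 \<le> (\<Sum>n. (cmod (cinner (G f) (\<Psi> n)))\<^sup>2)"
      using lo[of "G f"] by (simp add: power_mult_distrib mult.assoc)
    have "(norm (G f))\<^sup>2 \<le> (b * norm f)\<^sup>2"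
      using up by (intro power_mono) auto
    then have "B * (norm (G f))\<^sup>2 \<le> B * (b * norm f)\<^sup>2"
      using A by (intro mult_left_mono) auto
    then show "(\<Sum>n. (cmod (cinner (G f) (\<Psi> n)))\<^sup>2) \<le> B * b\<^sup>2 * (norm f)\<^sup>2"
      using hi[of "G f"] by (simp add: power_mult_distrib mult.assoc)
  qed
  then have bB': "bessel_bound \<Psi>' (B * b\<^sup>2)"
    by (rule frame_bounds_imp_bessel_bound)
  have an: "analysis_op \<Psi>' f = analysis_op \<Psi> (G f)" for f
    by (simp add: analysis_op_def \<Psi>')
  have "onorm (\<lambda>c. synthesis_op \<Psi> c - synthesis_op \<Psi>' c) \<le> sqrt B * e"
  proof (rule onorm_bound)
    show "0 \<le> sqrt B * e"
      using A near by simp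
    fix c
    define w where "w = synthesis_op \<Psi> c - synthesis_op \<Psi>' c"
    have "cinner w w = cinner (analysis_op \<Psi> w - analysis_op \<Psi>' w) c"
      by (subst (2) w_def)
        (simp add: cinner_minus_right cinner_minus_left cinner_synthesis[OF bB] cinner_synthesis[OF bB'])
    also have "analysis_op \<Psi> w - analysis_op \<Psi>' w = analysis_op \<Psi> (w - G w)"
      by (simp add: an linear_diff[OF bounded_linear.linear[OF bounded_linear_analysis[OF bB]]])
    finally have "norm w * norm w = cmod (cinner (analysis_op \<Psi> (w - G w)) c)"
      by (metis cinner_self norm_of_real abs_power2 power2_abs power2_eq_square abs_mult_self_eq)
    also have "\<dots> \<le> norm (analysis_op \<Psi> (w - G w)) * norm c"
      by (rule cauchy_schwarz)
    also have "\<dots> \<le> (sqrt B * (e * norm w)) * norm c"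
      using A near
      by (intro mult_right_mono order_trans[OF norm_analysis_le[OF bB]] mult_left_mono) auto
    finally have "norm w * norm w \<le> (sqrt B * e * norm c) * norm w"
      by (simp add: mult_ac)
    then have "norm w \<le> sqrt B * e * norm c"
      using mult_right_le_imp_le[of "norm w" "norm w" "sqrt B * e * norm c"] A near
      by (cases "w = 0") auto
    then show "norm (synthesis_op \<Psi> c - synthesis_op \<Psi>' c) \<le> sqrt B * e * norm c"
      by (simp add: w_def)
  qed
  then show ?thesis
    using fr an by (intro exI[of _ \<Psi>']) (auto simp: is_frame_def fun_eq_iff)
qed

theorem theorem2p5:
  fixes \<Phi> \<Psi> \<Phi>' :: "nat \<Rightarrow> 'a::complex_hilbert_space"
    and m :: "nat \<Rightarrow> complex"
    and A\<^sub>\<Phi> B\<^sub>\<Phi> A\<^sub>\<Psi> B\<^sub>\<Psi> \<mu> :: real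
  assumes separable: "\<exists>D :: 'a set. countable D \<and> closure D = UNIV"
    and frame_Phi: "frame_bounds \<Phi> A\<^sub>\<Phi> B\<^sub>\<Phi>"
    and frame_Psi: "frame_bounds \<Psi> A\<^sub>\<Psi> B\<^sub>\<Psi>"
    and m: "bounded (range m)"
    and inv: "invertible_op (multiplier m \<Phi> \<Psi>)"
    and pert: "perturbation \<mu> \<Phi> \<Phi>'"
    and mu: "\<mu> * sup_norm m < inverse (sqrt B\<^sub>\<Psi> * onorm (inv (multiplier m \<Phi> \<Psi>)))"
  shows "\<exists>\<Psi>'. is_frame \<Psi>' \<and> (\<exists>l>0. perturbation (l * \<mu>) \<Psi> \<Psi>') \<and>
           multiplier m \<Phi>' \<Psi>' = multiplier m \<Phi> \<Psi> \<and>
           (\<forall>P. P (multiplier m \<Phi> \<Psi>) \<longleftrightarrow> P (multiplier m \<Phi>' \<Psi>'))"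
proof -
  define M M' where "M = multiplier m \<Phi> \<Psi>" and "M' = multiplier m \<Phi>' \<Psi>"
  define R where "R = Hilbert_Choice.inv M"
  define q where "q = \<mu> * sup_norm m * (sqrt B\<^sub>\<Psi> * onorm R)"
  have bB: "bessel_bound \<Phi> B\<^sub>\<Phi>" "bessel_bound \<Psi> B\<^sub>\<Psi>"
    by (rule frame_bounds_imp_bessel_bound, fact)+
  then have B: "B\<^sub>\<Psi> > 0"
    by (simp add: bessel_bound_def)
  have \<mu>: "\<mu> > 0"
    using pert by (simp add: perturbation_def)
  obtain C where bC: "bessel_bound \<Phi>' C"
    using pert by (auto simp: perturbation_def bessel_def)
  have M: "bounded_linear M" and M': "bounded_linear M'"
    unfolding M_def M'_def
    by (rule bounded_linear_multiplier[OF bB m] bounded_linear_multiplier[OF bC bB(2) m])+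
  have R: "bounded_linear R" and bij: "bij M"
    using inv by (auto simp: invertible_op_def M_def R_def)
  have MR: "M (R f) = f" and RM: "R (M f) = f" for f
    using bij by (simp_all add: R_def bij_is_surj surj_f_inv_f bij_is_inj)
  interpret M: bounded_linear M by fact
  interpret R: bounded_linear R by fact
  have MC: "M (a *\<^sub>C f) = a *\<^sub>C M f" "M' (a *\<^sub>C f) = a *\<^sub>C M' f" for a f
    unfolding M_def M'_def by (rule multiplier_scaleC[OF bB m] multiplier_scaleC[OF bC bB(2) m])+
  have RC: "R (a *\<^sub>C f) = a *\<^sub>C R f" for a f
    by (metis MC(1) MR RM)
  have nonneg: "0 \<le> \<mu> * sup_norm m" "0 \<le> onorm R"
    using \<mu> sup_norm_nonneg[OF m] onorm_pos_le[OF R] by simp_all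
  have mu': "\<mu> * sup_norm m < inverse (sqrt B\<^sub>\<Psi> * onorm R)"
    using mu by (simp add: M_def R_def)
  \<comment> \<open>This rules out \<open>onorm R = 0\<close>, for which the inverse in the hypothesis would be \<open>0\<close>.\<close>
  have pos: "sqrt B\<^sub>\<Psi> * onorm R > 0"
    using mu' nonneg(1) by (metis inverse_positive_iff_positive order_le_less_trans)
  have q1: "q < 1"
    using mult_strict_right_mono[OF mu' pos] pos unfolding q_def
    by (metis left_inverse less_irrefl)
  have q0: "0 \<le> q"
    unfolding q_def using nonneg pos by (intro mult_nonneg_nonneg[OF nonneg(1)]) simp
  define K where "K f = R (M f - M' f)" for f
  have MK: "M (f - K f) = M' f" for f
    by (simp add: K_def M.diff MR)
  have Kbl: "bounded_linear K"
    unfolding K_def by (intro bounded_linear_compose[OF R] bounded_linear_sub M M')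
  have KC: "K (a *\<^sub>C f) = a *\<^sub>C K f" for a f
    by (simp add: K_def MC RC flip: scaleC_minus_right)
  have Kq: "norm (K f) \<le> q * norm f" for f
  proof -
    have "norm (K f) \<le> onorm R * norm (M f - M' f)"
      unfolding K_def by (rule onorm[OF R])
    also have "\<dots> \<le> onorm R * (\<mu> * (sup_norm m * (sqrt B\<^sub>\<Psi> * norm f)))"
      unfolding M_def M'_def
      by (intro mult_left_mono multiplier_perturbation_le[OF bB m pert] nonneg)
    finally show ?thesis
      by (simp add: q_def mult_ac)
  qed
  obtain G where G: "bounded_linear G" and GC: "\<And>a x. G (a *\<^sub>C x) = a *\<^sub>C G x"
    and GK: "\<And>x. G x - K (G x) = x" and Gle: "\<And>x. norm (G x) \<le> norm x / (1 - q)"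
    using neumann_inverse[OF Kbl KC q1 Kq] by blast
  have "\<exists>\<Psi>'. is_frame \<Psi>' \<and> analysis_op \<Psi>' = analysis_op \<Psi> \<circ> G \<and>
    onorm (\<lambda>c. synthesis_op \<Psi> c - synthesis_op \<Psi>' c) \<le> sqrt B\<^sub>\<Psi> * (q / (1 - q))"
  proof (rule transported_sequence[OF frame_Psi G GC])
    show "0 < 1 / (1 + q)"
      using q0 by simp
    show "1 / (1 + q) * norm x \<le> norm (G x)" for x
      using norm_triangle_ineq4[of "G x" "K (G x)"] Kq[of "G x"] q0
      by (simp add: GK field_simps)
    show "norm (G x) \<le> 1 / (1 - q) * norm x" for x
      using Gle by simp
    show "1 / (1 + q) \<le> 1 / (1 - q)"
      using q0 q1 by (intro divide_left_mono) auto
    show "0 \<le> q / (1 - q)"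
      using q0 q1 by simp
    show "norm (x - G x) \<le> q / (1 - q) * norm x" for x
    proof -
      have "norm (x - G x) = norm (K (G x))"
        using GK[of x] by (metis add_diff_cancel_left' diff_add_cancel norm_minus_commute)
      also have "\<dots> \<le> q * (norm x / (1 - q))"
        using q0 by (intro order_trans[OF Kq] mult_left_mono Gle)
      finally show ?thesis
        by simp
    qed
  qed
  then obtain \<Psi>' where fr: "is_frame \<Psi>'" and an: "analysis_op \<Psi>' = analysis_op \<Psi> \<circ> G"
    and on: "onorm (\<lambda>c. synthesis_op \<Psi> c - synthesis_op \<Psi>' c) \<le> sqrt B\<^sub>\<Psi> * (q / (1 - q))"
    by blast
  \<comment> \<open>The quotient times \<open>\<mu>\<close> is \<open>\<surd>B\<^sub>\<Psi> q / (1 - q)\<close>; adding \<open>1\<close> makes \<open>l > 0\<close> immediate.\<close>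
  define l where "l = B\<^sub>\<Psi> * sup_norm m * onorm R / (1 - q) + 1"
  have l: "l > 0"
    unfolding l_def using B q1 nonneg(2) sup_norm_nonneg[OF m]
    by (intro add_nonneg_pos divide_nonneg_pos mult_nonneg_nonneg) auto
  have "sqrt B\<^sub>\<Psi> * (q / (1 - q)) = (sqrt B\<^sub>\<Psi> * sqrt B\<^sub>\<Psi>) * sup_norm m * onorm R / (1 - q) * \<mu>"
    by (simp add: q_def mult_ac)
  also have "\<dots> \<le> l * \<mu>"
    using B \<mu> by (simp add: l_def distrib_right)
  finally have "onorm (\<lambda>c. synthesis_op \<Psi> c - synthesis_op \<Psi>' c) \<le> l * \<mu>"
    using on by linarith
  moreover have "bessel \<Psi>'"
    using fr frame_bounds_imp_bessel_bound by (auto simp: is_frame_def bessel_def)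
  ultimately have "perturbation (l * \<mu>) \<Psi> \<Psi>'"
    using l \<mu> by (simp add: perturbation_def)
  moreover have eq: "multiplier m \<Phi>' \<Psi>' = multiplier m \<Phi> \<Psi>"
  proof
    fix f
    have "multiplier m \<Phi>' \<Psi>' f = M' (G f)"
      by (simp add: multiplier_def an M'_def)
    also have "\<dots> = M f"
      by (simp add: GK flip: MK)
    finally show "multiplier m \<Phi>' \<Psi>' f = multiplier m \<Phi> \<Psi> f"
      by (simp add: M_def)
  qed
  ultimately show ?thesis
    using fr l by (intro exI[of _ \<Psi>']) auto
qed

end
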